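(* For every positive integer $n$, $$\sum_{k=1}^{n} k\binom{n}{k}^2\binom{n+k}{k}^2\left\{\frac{1}{2k}+\sum_{i=1}^{n+k}\frac{1}{i}+\sum_{i=1}^{n-k}\frac{1}{i}-2\sum_{i=1}^{k}\frac{1}{i}\right\}=0.$$
   Context: Here $\binom{a}{b}$ denotes the usual binomial coefficient, and an empty sum (such as $\sum_{i=1}^{n-k}\frac{1}{i}$ when $k=n$) equals $0$. The identity is an equality of rational numbers. *)

theory Defs
  imports Complex_Main
begin

end

(* With c_k = (-1)^k C(n,k) C(n+k,k) one has the partial fraction expansion
     prod_{i=1..n} (i - x) / prod_{i=0..n} (x + i) = sum_k c_k / (x + k).
   Clear denominators. The leading coefficient gives sum_k c_k = (-1)^n. The derivative at x = -k gives
   sum_{j /= k} c_j / (j - k) = - c_k (H_{n+k} + H_{n-k} - 2 H_k), which turns the harmonic part of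
   the claim into the double sum of - k c_k c_j / (j - k) over j /= k. Swapping j and k and averaging
   evaluates it to ((sum_k c_k)^2 - sum_k c_k^2) / 2. *)
theory Submission
  imports Defs "HOL-Computational_Algebra.Polynomial"
begin

text \<open>The residue at x = -k of the rational function being expanded. Its square, where the
  sign disappears, is the summand of the Apery numbers for zeta(3).\<close>

definition apery_coeff :: "nat \<Rightarrow> nat \<Rightarrow> rat" where
  "apery_coeff n k = (- 1) ^ k * of_nat (n choose k) * of_nat ((n + k) choose k)"

text \<open>The denominator without its factor x + k, evaluated at x = -k: the k factors with i < k
  are negative and give the sign and k!, those with i > k give (n-k)!.\<close>

lemma prod_diff_index:
  assumes "k \<le> n"
  shows "(\<Prod>i\<in>{0..n} - {k}. of_nat i - of_nat k :: rat) = (- 1) ^ k * fact k * fact (n - k)"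
proof -
  have split: "{0..n} - {k} = {0..<k} \<union> {k+1..n}" using assms by auto
  have "(\<Prod>i\<in>{0..<k}. of_nat i - of_nat k :: rat) = (\<Prod>i\<in>{1..k}. - of_nat i)"
    by (rule prod.reindex_bij_witness[of _ "\<lambda>i. k - i" "\<lambda>i. k - i"]) (auto simp: of_nat_diff)
  also have "\<dots> = (- 1) ^ k * fact k"
    by (simp add: prod_uminus fact_prod)
  finally have low: "(\<Prod>i\<in>{0..<k}. of_nat i - of_nat k :: rat) = (- 1) ^ k * fact k" .
  have "(\<Prod>i\<in>{k+1..n}. of_nat i - of_nat k :: rat) = (\<Prod>i\<in>{1..n-k}. of_nat i)"
    using assms
    by (intro prod.reindex_bij_witness[of _ "\<lambda>i. i + k" "\<lambda>i. i - k"]) (auto simp: of_nat_diff)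
  also have "\<dots> = fact (n - k)"
    by (simp add: fact_prod)
  finally have high: "(\<Prod>i\<in>{k+1..n}. of_nat i - of_nat k :: rat) = fact (n - k)" .
  show ?thesis
    unfolding split by (subst prod.union_disjoint) (auto simp: low high[simplified])
qed

text \<open>The logarithmic derivative at x = -k of the product in \<open>prod_diff_index\<close>,
  split at k in the same way.\<close>

lemma sum_inverse_diff_index:
  assumes "k \<le> n"
  shows "(\<Sum>i\<in>{0..n} - {k}. 1 / (of_nat i - of_nat k :: rat)) =
    (\<Sum>i = 1..n - k. 1 / of_nat i) - (\<Sum>i = 1..k. 1 / of_nat i)"
proof -
  have split: "{0..n} - {k} = {0..<k} \<union> {k+1..n}" using assms by auto
  have "(\<Sum>i\<in>{0..<k}. 1 / (of_nat i - of_nat k :: rat)) = (\<Sum>i\<in>{1..k}. - (1 / of_nat i))"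
    by (rule sum.reindex_bij_witness[of _ "\<lambda>i. k - i" "\<lambda>i. k - i"])
       (auto simp: of_nat_diff divide_simps)
  then have low: "(\<Sum>i\<in>{0..<k}. 1 / (of_nat i - of_nat k :: rat)) = - (\<Sum>i = 1..k. 1 / of_nat i)"
    by (simp add: sum_negf)
  have high: "(\<Sum>i\<in>{k+1..n}. 1 / (of_nat i - of_nat k :: rat)) = (\<Sum>i\<in>{1..n-k}. 1 / of_nat i)"
    using assms
    by (intro sum.reindex_bij_witness[of _ "\<lambda>i. i + k" "\<lambda>i. i - k"]) (auto simp: of_nat_diff)
  show ?thesis
    unfolding split by (subst sum.union_disjoint) (auto simp: low high[simplified])
qed

text \<open>Up to sign, the logarithmic derivative of the numerator at x = -k.\<close>

lemma sum_inverse_shift: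
  "(\<Sum>i = 1..n. 1 / (of_nat i + of_nat k :: rat)) =
    (\<Sum>i = 1..n + k. 1 / of_nat i) - (\<Sum>i = 1..k. 1 / of_nat i)"
  by (induction n) (simp_all add: add_ac)

lemma prod_shift: "(\<Prod>i = 1..n. of_nat i + of_nat k :: rat) = fact (n + k) / fact k"
  by (induction n) (simp_all add: algebra_simps)

lemma apery_coeff_residue:
  assumes "k \<le> n"
  shows "apery_coeff n k * (\<Prod>i\<in>{0..n} - {k}. of_nat i - of_nat k) =
    (\<Prod>i = 1..n. of_nat i + of_nat k)"
proof -
  have "of_nat (n choose k) = (fact n / (fact k * fact (n - k)) :: rat)"
    using assms by (rule binomial_fact)
  moreover have "of_nat ((n + k) choose k) = (fact (n + k) / (fact k * fact n) :: rat)"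
    using binomial_fact[of k "n + k", where ?'a = rat] by simp
  moreover have "(- 1 :: rat) ^ k * (- 1) ^ k = 1"
    by (simp flip: power_mult_distrib)
  ultimately show ?thesis
    unfolding prod_diff_index[OF assms] prod_shift apery_coeff_def by simp
qed

text \<open>Both sides have degree at most n, so agreement at the n + 1 points 0, -1, ..., -n
  suffices. At -k every summand with j \<noteq> k contains the vanishing factor x + k, and the
  remaining one is \<open>apery_coeff_residue\<close>.\<close>

lemma apery_partial_fractions:
  "(\<Sum>j = 0..n. smult (apery_coeff n j) (\<Prod>i\<in>{0..n} - {j}. [:of_nat i, 1:])) =
    (\<Prod>i = 1..n. [:of_nat i, - 1:])" (is "?L = ?R")
proof (rule poly_eqI_degree)
  show "poly ?L x = poly ?R x" if "x \<in> (\<lambda>k. - of_nat k) ` {0..n}" for x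
  proof -
    from that obtain k where k: "k \<le> n" "x = - of_nat k" by auto
    have "poly ?L x = (\<Sum>j = 0..n. if j = k
        then apery_coeff n k * (\<Prod>i\<in>{0..n} - {k}. of_nat i - of_nat k) else 0)"
      unfolding poly_sum using k
      by (intro sum.cong) (auto simp: poly_prod prod_zero_iff intro!: bexI[of _ k])
    also have "\<dots> = poly ?R x"
      using k apery_coeff_residue[OF k(1)] by (simp add: poly_prod)
    finally show ?thesis .
  qed
  have card: "card ((\<lambda>k. - of_nat k :: rat) ` {0..n}) = Suc n"
    by (subst card_image) (auto simp: inj_on_def)
  have "degree (\<Prod>i\<in>{0..n} - {j}. [:of_nat i, 1 :: rat:]) \<le> n" if "j \<le> n" for j
    using that by (subst degree_prod_eq_sum_degree) auto
  then have "degree ?L \<le> n"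
    by (intro degree_sum_le) (auto intro: order_trans[OF degree_smult_le])
  then show "degree ?L < card ((\<lambda>k. - of_nat k :: rat) ` {0..n})"
    unfolding card by simp
  have "degree ?R \<le> n"
    by (subst degree_prod_eq_sum_degree) auto
  then show "degree ?R < card ((\<lambda>k. - of_nat k :: rat) ` {0..n})"
    unfolding card by simp
qed

text \<open>Compare coefficients of x^n: each product on the left is monic of degree n, while the
  right side has n factors of slope -1.\<close>

lemma sum_apery_coeff: "(\<Sum>j = 0..n. apery_coeff n j) = (- 1) ^ n"
proof -
  have "coeff (\<Prod>i\<in>{0..n} - {j}. [:of_nat i, 1 :: rat:]) n = 1" if "j \<le> n" for j
  proof -
    have "degree (\<Prod>i\<in>{0..n} - {j}. [:of_nat i, 1 :: rat:]) = n"
      using that by (subst degree_prod_eq_sum_degree) auto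
    then show ?thesis
      using lead_coeff_prod[of "\<lambda>i. [:of_nat i, 1 :: rat:]" "{0..n} - {j}"] by simp
  qed
  then have "coeff (\<Sum>j = 0..n. smult (apery_coeff n j) (\<Prod>i\<in>{0..n} - {j}. [:of_nat i, 1:])) n =
      (\<Sum>j = 0..n. apery_coeff n j)"
    by (simp add: coeff_sum)
  moreover have "coeff (\<Prod>i = 1..n. [:of_nat i, - 1 :: rat:]) n = (- 1) ^ n"
  proof -
    have "degree (\<Prod>i = 1..n. [:of_nat i, - 1 :: rat:]) = n"
      by (subst degree_prod_eq_sum_degree) auto
    then show ?thesis
      using lead_coeff_prod[of "\<lambda>i. [:of_nat i, - 1 :: rat:]" "{1..n}"] by simp
  qed
  ultimately show ?thesis
    by (simp add: apery_partial_fractions)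
qed

lemma poly_pderiv_prod_linear:
  fixes a b :: "'i \<Rightarrow> 'a::field_char_0"
  assumes "finite I" "\<And>i. i \<in> I \<Longrightarrow> a i + b i * x \<noteq> 0"
  shows "poly (pderiv (\<Prod>i\<in>I. [:a i, b i:])) x =
    (\<Prod>i\<in>I. a i + b i * x) * (\<Sum>i\<in>I. b i / (a i + b i * x))"
proof -
  have "poly (pderiv (\<Prod>i\<in>I. [:a i, b i:])) x =
      (\<Sum>i\<in>I. (\<Prod>j\<in>I - {i}. a j + b j * x) * b i)"
    by (simp add: pderiv_prod poly_sum poly_prod pderiv_pCons mult.commute)
  also have "\<dots> = (\<Sum>i\<in>I. (\<Prod>i\<in>I. a i + b i * x) * (b i / (a i + b i * x)))"
    using assms by (intro sum.cong refl) (simp add: prod.remove[of I])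
  finally show ?thesis
    by (simp add: sum_distrib_left)
qed

text \<open>Differentiating the cleared identity at x = -k and dividing by d = \<open>?d\<close>
  gives the claim: the summand j = k yields c_k d (H_{n-k} - H_k), the others d c_j / (j - k), and
  the right side -c_k d (H_{n+k} - H_k).\<close>

lemma sum_apery_coeff_div_diff:
  assumes "k \<le> n"
  shows "(\<Sum>j\<in>{0..n} - {k}. apery_coeff n j / (of_nat j - of_nat k)) =
    - apery_coeff n k * ((\<Sum>i = 1..n + k. 1 / of_nat i) + (\<Sum>i = 1..n - k. 1 / of_nat i)
      - 2 * (\<Sum>i = 1..k. 1 / of_nat i))"
    (is "?S = - ?c * ?H")
proof -
  let ?D = "\<lambda>j. \<Prod>i\<in>{0..n} - {j}. [:of_nat i, 1 :: rat:]"
  let ?d = "\<Prod>i\<in>{0..n} - {k}. of_nat i - of_nat k :: rat"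
  let ?x = "- of_nat k :: rat"
  have d: "?d \<noteq> 0" by simp
  have Dk: "poly (pderiv (?D k)) ?x = ?d * (\<Sum>i\<in>{0..n} - {k}. 1 / (of_nat i - of_nat k))"
    by (subst poly_pderiv_prod_linear) auto
  \<comment> \<open>For j \<noteq> k the factor x + k is present and vanishes at -k, so only the
    product rule term that differentiates it survives.\<close>
  have Dj: "poly (pderiv (?D j)) ?x = ?d / (of_nat j - of_nat k)" if "j \<in> {0..n} - {k}" for j
  proof -
    have "?D j = [:of_nat k, 1:] * (\<Prod>i\<in>{0..n} - {j} - {k}. [:of_nat i, 1:])"
      using assms that by (subst prod.remove[of _ k]) auto
    then have "poly (pderiv (?D j)) ?x = (\<Prod>i\<in>{0..n} - {j} - {k}. of_nat i - of_nat k)"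
      by (simp add: pderiv_mult pderiv_pCons poly_prod del: mult_pCons_left)
    also have "{0..n} - {j} - {k} = {0..n} - {k} - {j}" by auto
    also have "(\<Prod>i\<in>{0..n} - {k} - {j}. of_nat i - of_nat k) = ?d / (of_nat j - of_nat k)"
      using that by (subst prod.remove[of "{0..n} - {k}" j]) auto
    finally show ?thesis .
  qed
  have "poly (pderiv (\<Sum>j = 0..n. smult (apery_coeff n j) (?D j))) ?x =
      (\<Sum>j = 0..n. apery_coeff n j * poly (pderiv (?D j)) ?x)"
    by (simp add: higher_pderiv_sum[of 1, simplified] pderiv_smult poly_sum)
  also have "\<dots> = ?c * poly (pderiv (?D k)) ?x
      + (\<Sum>j\<in>{0..n} - {k}. apery_coeff n j * poly (pderiv (?D j)) ?x)"
    using assms by (subst sum.remove[of _ k]) auto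
  also have "(\<Sum>j\<in>{0..n} - {k}. apery_coeff n j * poly (pderiv (?D j)) ?x) = ?d * ?S"
    unfolding sum_distrib_left by (rule sum.cong) (auto simp: Dj)
  finally have "?c * poly (pderiv (?D k)) ?x + ?d * ?S =
      poly (pderiv (\<Prod>i = 1..n. [:of_nat i, - 1:])) ?x"
    by (simp only: apery_partial_fractions)
  also have "\<dots> = (?c * ?d) * - (\<Sum>i = 1..n. 1 / (of_nat i + of_nat k))"
  proof (subst poly_pderiv_prod_linear)
    show "of_nat i + - 1 * ?x \<noteq> 0" if "i \<in> {1..n}" for i
      using that by (simp flip: of_nat_add)
  qed (simp_all add: apery_coeff_residue[OF assms, simplified] sum_negf)
  finally have "?d * ?S = ?d * (- ?c * ?H)"
    unfolding Dk sum_inverse_shift sum_inverse_diff_index[OF assms] by (simp add: algebra_simps)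
  with d show ?thesis by (simp only: mult_cancel_left) simp
qed

text \<open>Adding the double sum to its copy with k and j swapped uses x_k / (x_j - x_k) + x_j /
  (x_k - x_j) = -1, so only -c_k c_j over k \<noteq> j is left. Injectivity keeps the denominators
  nonzero.\<close>

lemma sum_weighted_cauchy_antisym:
  fixes c x :: "'i \<Rightarrow> 'a::field_char_0"
  assumes "finite A" "inj_on x A"
  shows "2 * (\<Sum>k\<in>A. x k * c k * (\<Sum>j\<in>A - {k}. c j / (x j - x k))) =
    (\<Sum>k\<in>A. c k ^ 2) - (\<Sum>k\<in>A. c k) ^ 2"
proof -
  \<comment> \<open>The zero diagonal lets both indices range over all of \<open>A\<close>, so that
    \<open>sum.swap\<close> applies.\<close>
  let ?f = "\<lambda>k j. if j = k then 0 else x k * c k * c j / (x j - x k)"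
  have "(\<Sum>k\<in>A. x k * c k * (\<Sum>j\<in>A - {k}. c j / (x j - x k))) = (\<Sum>k\<in>A. \<Sum>j\<in>A. ?f k j)"
    unfolding sum_distrib_left using assms
    by (intro sum.cong refl sum.mono_neutral_cong_left) auto
  then have "2 * (\<Sum>k\<in>A. x k * c k * (\<Sum>j\<in>A - {k}. c j / (x j - x k))) =
      (\<Sum>k\<in>A. \<Sum>j\<in>A. ?f k j) + (\<Sum>k\<in>A. \<Sum>j\<in>A. ?f j k)"
    by (subst (2) sum.swap) simp
  also have "\<dots> = (\<Sum>k\<in>A. \<Sum>j\<in>A. (if j = k then c k ^ 2 else 0) - c k * c j)"
    unfolding sum.distrib[symmetric]
  proof (intro sum.cong refl)
    fix k j assume "k \<in> A" "j \<in> A"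
    show "?f k j + ?f j k = (if j = k then c k ^ 2 else 0) - c k * c j"
    proof (cases "j = k")
      case False
      then have "x j - x k \<noteq> 0" "x k - x j \<noteq> 0"
        using assms \<open>k \<in> A\<close> \<open>j \<in> A\<close> by (auto dest: inj_onD)
      with False show ?thesis by (simp add: divide_simps) (simp add: algebra_simps)
    qed (simp add: power2_eq_square)
  qed
  also have "\<dots> = (\<Sum>k\<in>A. c k ^ 2) - (\<Sum>k\<in>A. c k) ^ 2"
    using assms by (simp add: sum_subtractf power2_eq_square sum_product)
  finally show ?thesis .
qed

theorem mainTheorem1:
  fixes n :: nat
  assumes "n \<ge> 1"
  shows "(\<Sum>k::nat = 1..n. of_nat k * of_nat (n choose k) ^ 2 * of_nat ((n + k) choose k) ^ 2 *
            (1 / (2 * of_nat k)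
             + (\<Sum>i::nat = 1..n + k. 1 / of_nat i)
             + (\<Sum>i::nat = 1..n - k. 1 / of_nat i)
             - 2 * (\<Sum>i::nat = 1..k. 1 / of_nat i))) = (0 :: rat)"
    (is "sum ?t _ = 0")
proof -
  let ?c = "apery_coeff n"
  let ?S = "\<lambda>k. \<Sum>j\<in>{0..n} - {k}. ?c j / (of_nat j - of_nat k)"
  have sq: "of_nat (n choose k) ^ 2 * of_nat ((n + k) choose k) ^ 2 = ?c k ^ 2" for k
    by (simp add: apery_coeff_def power_mult_distrib flip: power_mult)
  have summand: "?t k = ?c k ^ 2 / 2 - of_nat k * ?c k * ?S k" if "k \<in> {1..n}" for k
  proof -
    let ?H = "(\<Sum>i = 1..n + k. 1 / of_nat i) + (\<Sum>i = 1..n - k. 1 / of_nat i)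
      - 2 * (\<Sum>i = 1..k. 1 / of_nat i) :: rat"
    have "?t k = of_nat k * ?c k ^ 2 * (1 / (2 * of_nat k) + ?H)"
      unfolding sq[symmetric] by (simp add: algebra_simps)
    \<comment> \<open>Since k \<ge> 1, the weight k cancels against 1/(2k).\<close>
    also have "\<dots> = ?c k ^ 2 / 2 + of_nat k * ?c k ^ 2 * ?H"
      unfolding distrib_left using that by simp
    also have "of_nat k * ?c k ^ 2 * ?H = - (of_nat k * ?c k * (- ?c k * ?H))"
      by (simp add: power2_eq_square)
    also have "- ?c k * ?H = ?S k"
      using that sum_apery_coeff_div_diff[of k n] by simp
    finally show ?thesis by simp
  qed
  have "2 * (\<Sum>k = 1..n. ?t k) = 2 * (\<Sum>k = 1..n. ?c k ^ 2 / 2 - of_nat k * ?c k * ?S k)"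
    using summand by simp
  also have "\<dots> = (\<Sum>k = 1..n. ?c k ^ 2) - 2 * (\<Sum>k = 1..n. of_nat k * ?c k * ?S k)"
    by (simp add: sum_subtractf right_diff_distrib flip: sum_divide_distrib)
  \<comment> \<open>The weight k kills the new term k = 0; the inner sums already run from
    0.\<close>
  also have "(\<Sum>k = 1..n. of_nat k * ?c k * ?S k) = (\<Sum>k = 0..n. of_nat k * ?c k * ?S k)"
    by (simp add: sum.atLeast_Suc_atMost)
  also have "2 * \<dots> = (\<Sum>k = 0..n. ?c k ^ 2) - (\<Sum>k = 0..n. ?c k) ^ 2"
    by (rule sum_weighted_cauchy_antisym) (auto simp: inj_on_def)
  \<comment> \<open>The 1 is c_0^2; it cancels against the squared coefficient sum ((-1)^n)^2 =
    1.\<close>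
  also have "(\<Sum>k = 0..n. ?c k ^ 2) = 1 + (\<Sum>k = 1..n. ?c k ^ 2)"
    by (simp add: sum.atLeast_Suc_atMost apery_coeff_def)
  finally show ?thesis
    by (simp add: sum_apery_coeff flip: power_mult)
qed

end
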